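(* Let $G$ be a finite abelian group of order $n\ge2$ and let $t$ be an integer with $2\le t\le n-1$. Then $$s(G,t) \ge \left\lfloor \left( \frac{n}{2\,\sigma(G,t)}\right)^{1/t}\right\rfloor.$$
   Context: $G$ is written additively. For a positive integer $h$, $\mathrm{Tor}(G,h)=\{x\in G : hx=0\}$, and $\sigma(G,t)=\sum_{k=1}^t |\mathrm{Tor}(G,k)|$. A subset $A=\{a_1,\dots,a_m\}$ (with $m\ge1$) of $G$ is called $t$-independent if whenever $\lambda_1a_1+\cdots+\lambda_ma_m=0$ for integers $\lambda_i$ with $\sum|\lambda_i|\le t$, we have all $\lambda_i=0$. $s(G,t)$ denotes the largest size of a $t$-independent subset of $G$ ($0$ if there is none). *)

theory Defs
  imports Complex_Main "HOL-Algebra.Algebra"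
begin

text \<open>
  Groups are \<^locale>\<open>comm_group\<close> structures, which the library writes multiplicatively.
  The additive multiple \<open>k a\<close> is therefore the power \<open>a [^] k\<close>, a finite sum is
  \<^const>\<open>finprod\<close>, and the neutral element is \<open>\<one>\<close>.
\<close>

definition Tor :: "('a, 'b) monoid_scheme \<Rightarrow> nat \<Rightarrow> 'a set" where
  "Tor G h = {x \<in> carrier G. x [^]\<^bsub>G\<^esub> h = \<one>\<^bsub>G\<^esub>}"

definition tor_sum :: "('a, 'b) monoid_scheme \<Rightarrow> nat \<Rightarrow> nat" where
  "tor_sum G t = (\<Sum>k = 1..t. card (Tor G k))"

text \<open>
  The coefficients \<open>\<lambda>\<^sub>1, \<dots>, \<lambda>\<^sub>m\<close> attached to the distinct elements of \<open>A\<close> are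
  a function on \<open>A\<close>; its values outside \<open>A\<close> are irrelevant.
\<close>

definition t_independent :: "('a, 'b) monoid_scheme \<Rightarrow> nat \<Rightarrow> 'a set \<Rightarrow> bool" where
  "t_independent G t A \<longleftrightarrow>
     A \<subseteq> carrier G \<and> finite A \<and> A \<noteq> {} \<and>
     (\<forall>l :: 'a \<Rightarrow> int.
        finprod G (\<lambda>a. a [^]\<^bsub>G\<^esub> l a) A = \<one>\<^bsub>G\<^esub> \<and> (\<Sum>a\<in>A. \<bar>l a\<bar>) \<le> int t
        \<longrightarrow> (\<forall>a\<in>A. l a = 0))"

text \<open>
  Only meaningful for finite groups, where the maximum ranges over a finite set. The inserted
  \<open>0\<close> gives the value when there is no \<open>t\<close>-independent subset; otherwise it is harmless.
\<close>

definition max_indep_size :: "('a, 'b) monoid_scheme \<Rightarrow> nat \<Rightarrow> nat" where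
  "max_indep_size G t = Max (insert 0 (card ` {A. t_independent G t A}))"

end

theory Submission
  imports Defs
begin

text \<open>
  A \<open>t\<close>-independent set \<open>A\<close> with \<open>m\<close> elements can be enlarged by any \<open>x\<close> such that no \<open>x\<^sup>k\<close> with
  \<open>1 \<le> k \<le> t\<close> is a combination of \<open>A\<close> with coefficient norm at most \<open>t - 1\<close>. There are fewer than
  \<open>2 (m + 1)\<^sup>t\<^sup>-\<^sup>1\<close> such combinations, and each has at most \<open>|Tor(G, k)|\<close> many \<open>k\<close>-th roots, so a
  suitable \<open>x\<close> exists as long as \<open>2 \<sigma>(G, t) (m + 1)\<^sup>t\<^sup>-\<^sup>1 \<le> n\<close>.
\<close>

text \<open>The image in \<open>G\<close> of the integer points of the l1-ball of radius
  \<open>r\<close> in Z^A.\<close>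

definition combos :: "('a, 'b) monoid_scheme \<Rightarrow> 'a set \<Rightarrow> nat \<Rightarrow> 'a set" where
  "combos G A r = {finprod G (\<lambda>a. a [^]\<^bsub>G\<^esub> l a) A | l :: 'a \<Rightarrow> int. (\<Sum>a\<in>A. \<bar>l a\<bar>) \<le> int r}"

text \<open>Arithmetic for the inductive step of \<open>card_combos_less\<close>, where a set of
  size \<open>m\<close> gains one element. The summand 1 keeps the case \<open>m = 0\<close>
  true.\<close>

lemma power_Suc_le_Suc_mult_power:
  fixes m r :: nat
  shows "(m + 1) ^ Suc r \<le> 1 + m * (m + 2) ^ r"
proof (induction r)
  case 0
  then show ?case by simp
next
  case (Suc r)
  have "(m + 1) ^ Suc (Suc r) \<le> (m + 1) * (1 + m * (m + 2) ^ r)"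
    using mult_le_mono2[OF Suc.IH, of "m + 1"] by simp
  also have "\<dots> = 1 + m * ((m + 1) * (m + 2) ^ r + 1)"
    by (simp add: algebra_simps)
  also have "\<dots> \<le> 1 + m * (m + 2) ^ Suc r"
  proof -
    have "1 \<le> (m + 2) ^ r" by simp
    then have "(m + 1) * (m + 2) ^ r + 1 \<le> (m + 2) ^ Suc r"
      by (simp add: algebra_simps)
    then show ?thesis by (intro add_mono mult_le_mono2) auto
  qed
  finally show ?case .
qed

lemma powr_inverse_power:
  fixes x :: real
  assumes "0 < x" "0 < t"
  shows "(x powr (1 / real t)) ^ t = x"
  using assms by (simp add: powr_power)

context comm_group
begin

section \<open>Counting combinations of bounded coefficient norm\<close>

lemma finprod_int_pow_insert:
  fixes l :: "'a \<Rightarrow> int"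
  assumes "finite A" "x \<notin> A" "x \<in> carrier G" "A \<subseteq> carrier G"
  shows "finprod G (\<lambda>a. a [^] l a) (insert x A) = x [^] l x \<otimes> finprod G (\<lambda>a. a [^] l a) A"
  using assms by (intro finprod_insert) auto

lemma finprod_int_pow_closed:
  fixes l :: "'a \<Rightarrow> int"
  assumes "A \<subseteq> carrier G"
  shows "finprod G (\<lambda>a. a [^] l a) A \<in> carrier G"
  using assms by (intro finprod_closed) auto

lemma finprod_int_pow_uminus:
  fixes l :: "'a \<Rightarrow> int"
  assumes "A \<subseteq> carrier G"
  shows "finprod G (\<lambda>a. a [^] (- l a)) A = inv (finprod G (\<lambda>a. a [^] l a) A)"
proof -
  have "finprod G (\<lambda>a. a [^] (- l a)) A \<otimes> finprod G (\<lambda>a. a [^] l a) A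
      = finprod G (\<lambda>a. a [^] (- l a) \<otimes> a [^] l a) A"
    using assms by (intro finprod_multf[symmetric]) auto
  also have "\<dots> = \<one>"
    using assms by (intro finprod_one_eqI) (auto simp: int_pow_neg)
  finally show ?thesis
    using assms by (intro inv_equality[symmetric] finprod_int_pow_closed)
qed

lemma combos_subset_carrier: "A \<subseteq> carrier G \<Longrightarrow> combos G A r \<subseteq> carrier G"
  unfolding combos_def using finprod_int_pow_closed by blast

lemma combos_eq_one:
  assumes "finite A" "A = {} \<or> r = 0"
  shows "combos G A r = {\<one>}"
proof -
  have "finprod G (\<lambda>a. a [^] l a) A = \<one>" if "(\<Sum>a\<in>A. \<bar>l a\<bar>) \<le> int r" for l :: "'a \<Rightarrow> int"
  proof (cases "A = {}")
    case False
    then have "(\<Sum>a\<in>A. \<bar>l a\<bar>) = 0"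
      using assms(2) that by (simp add: order_antisym sum_nonneg)
    then have "\<forall>a\<in>A. l a = 0"
      using assms(1) by (simp add: sum_nonneg_eq_0_iff)
    then show ?thesis by (intro finprod_one_eqI) simp
  qed simp
  moreover have "\<one> \<in> combos G A r"
    unfolding combos_def by (intro CollectI exI[of _ "\<lambda>_. 0"]) simp
  ultimately show ?thesis unfolding combos_def by blast
qed

text \<open>If the coefficient of \<open>x\<close> is zero, only \<open>A\<close> contributes.
  Otherwise one factor \<open>x\<close> or \<open>inv x\<close> is split off, according to the sign
  of the coefficient, which lowers the norm by one. This gives a recurrence for the number of
  combinations.\<close>

lemma combos_insert_Suc:
  assumes "finite A" "x \<notin> A" "x \<in> carrier G" "A \<subseteq> carrier G"
  shows "combos G (insert x A) (Suc r) \<subseteq> combos G A (Suc r)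
    \<union> (\<lambda>y. x \<otimes> y) ` combos G (insert x A) r \<union> (\<lambda>y. inv x \<otimes> y) ` combos G (insert x A) r"
proof
  fix y assume "y \<in> combos G (insert x A) (Suc r)"
  then obtain l :: "'a \<Rightarrow> int" where
    y: "y = finprod G (\<lambda>a. a [^] l a) (insert x A)" and
    l: "(\<Sum>a\<in>insert x A. \<bar>l a\<bar>) \<le> int (Suc r)"
    unfolding combos_def by blast
  let ?P = "finprod G (\<lambda>a. a [^] l a) A"
  have P: "?P \<in> carrier G" using assms finprod_int_pow_closed by blast
  have y': "y = x [^] l x \<otimes> ?P"
    using y assms by (simp add: finprod_int_pow_insert)
  have l': "\<bar>l x\<bar> + (\<Sum>a\<in>A. \<bar>l a\<bar>) \<le> int r + 1"
    using l assms by simp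
  \<comment> \<open>Moving the coefficient of \<open>x\<close> one step towards zero saves one unit
    of norm; \<open>i\<close> will be \<open>l x - 1\<close> or \<open>l x + 1\<close>.\<close>
  have shift: "x [^] i \<otimes> ?P \<in> combos G (insert x A) r" if "\<bar>i\<bar> = \<bar>l x\<bar> - 1" for i :: int
  proof -
    let ?l = "l(x := i)"
    have eq: "finprod G (\<lambda>a. a [^] ?l a) A = ?P"
      using assms by (intro finprod_cong') auto
    have "(\<Sum>a\<in>A. \<bar>?l a\<bar>) = (\<Sum>a\<in>A. \<bar>l a\<bar>)"
      using assms by (intro sum.cong) auto
    then have "(\<Sum>a\<in>insert x A. \<bar>?l a\<bar>) \<le> int r"
      using l' that assms by simp
    moreover have "x [^] i \<otimes> ?P = finprod G (\<lambda>a. a [^] ?l a) (insert x A)"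
      using finprod_int_pow_insert[OF assms, of ?l] eq by simp
    ultimately show ?thesis unfolding combos_def by blast
  qed
  consider "l x = 0" | "l x > 0" | "l x < 0" by linarith
  then show "y \<in> combos G A (Suc r)
    \<union> (\<lambda>y. x \<otimes> y) ` combos G (insert x A) r \<union> (\<lambda>y. inv x \<otimes> y) ` combos G (insert x A) r"
  proof cases
    case 1
    then have "y = ?P" "(\<Sum>a\<in>A. \<bar>l a\<bar>) \<le> int (Suc r)" using y' P l' by auto
    then show ?thesis unfolding combos_def by blast
  next
    case 2
    have "x [^] l x = x \<otimes> x [^] (l x - 1)"
      using int_pow_mult[of x 1 "l x - 1"] assms by simp
    then have "y = x \<otimes> (x [^] (l x - 1) \<otimes> ?P)"
      using y' P assms by (simp add: m_assoc)
    then show ?thesis using shift[of "l x - 1"] 2 by auto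
  next
    case 3
    have "x [^] l x = inv x \<otimes> x [^] (l x + 1)"
      using int_pow_mult[of x "-1" "l x + 1"] assms by (simp add: int_pow_neg)
    then have "y = inv x \<otimes> (x [^] (l x + 1) \<otimes> ?P)"
      using y' P assms by (simp add: m_assoc)
    then show ?thesis using shift[of "l x + 1"] 3 by auto
  qed
qed

text \<open>Double induction, on \<open>A\<close> and then on \<open>r\<close>, along the recurrence
  \<open>combos_insert_Suc\<close>. The outer hypothesis is general in \<open>r\<close> because it
  is applied at \<open>Suc r\<close>. In both base cases the identity is the only
  combination.\<close>

lemma card_combos_less:
  assumes "finite (carrier G)" "A \<subseteq> carrier G"
  shows "card (combos G A r) < 2 * (card A + 1) ^ r"
proof -
  have "finite A" using assms finite_subset by blast
  then show ?thesis using assms(2)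
  proof (induction A arbitrary: r rule: finite_induct)
    case empty
    then show ?case by (simp add: combos_eq_one)
  next
    case (insert x A)
    show ?case
    proof (induction r)
      case 0
      then show ?case using insert.hyps by (simp add: combos_eq_one)
    next
      case (Suc r)
      let ?B = "combos G (insert x A) r" and ?m = "card A"
      have fin: "finite (combos G C s)" if "C \<subseteq> carrier G" for C s
        using combos_subset_carrier[OF that] assms(1) finite_subset by blast
      have finB: "finite ?B" using fin insert.prems by blast
      have "card (combos G (insert x A) (Suc r))
          \<le> card (combos G A (Suc r) \<union> (\<lambda>y. x \<otimes> y) ` ?B \<union> (\<lambda>y. inv x \<otimes> y) ` ?B)"
        using combos_insert_Suc[of A x r] insert.hyps insert.prems fin finB
        by (intro card_mono) auto
      also have "\<dots> \<le> card (combos G A (Suc r)) + card ((\<lambda>y. x \<otimes> y) ` ?B)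
          + card ((\<lambda>y. inv x \<otimes> y) ` ?B)"
        by (rule order_trans[OF card_Un_le]) (simp add: card_Un_le)
      also have "\<dots> \<le> card (combos G A (Suc r)) + card ?B + card ?B"
        using card_image_le[OF finB] by (intro add_mono) auto
      finally have le: "card (combos G (insert x A) (Suc r))
          \<le> card (combos G A (Suc r)) + 2 * card ?B" by simp
      have "card (combos G A (Suc r)) < 2 * (?m + 1) ^ Suc r"
        using insert.IH insert.prems by blast
      moreover have "card ?B < 2 * (?m + 2) ^ r"
        using Suc.IH insert.hyps by simp
      moreover have "(?m + 2) ^ Suc r = ?m * (?m + 2) ^ r + 2 * (?m + 2) ^ r"
        by (simp add: algebra_simps)
      \<comment> \<open>The two strict bounds leave an integer slack of 1 + 2 = 3, which absorbs the
        excess 2 that comes from doubling the power inequality with its summand 1.\<close>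
      ultimately have "card (combos G (insert x A) (Suc r)) < 2 * (?m + 2) ^ Suc r"
        using le power_Suc_le_Suc_mult_power[of ?m r] by linarith
      then show ?case using insert.hyps by simp
    qed
  qed
qed

section \<open>Counting roots\<close>

text \<open>The \<open>k\<close>-th power map is an endomorphism with kernel \<open>Tor G k\<close>,
  so a fibre is empty or a coset of the kernel; dividing by one root \<open>z\<close> maps it into
  \<open>Tor G k\<close>.\<close>

lemma card_roots_le_Tor:
  assumes "finite (carrier G)"
  shows "card {x \<in> carrier G. x [^] (k::nat) = y} \<le> card (Tor G k)"
proof (cases "{x \<in> carrier G. x [^] k = y} = {}")
  case False
  then obtain z where z: "z \<in> carrier G" "z [^] k = y" by blast
  have "inj_on (\<lambda>x. inv z \<otimes> x) {x \<in> carrier G. x [^] k = y}"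
    using z by (auto intro!: inj_onI)
  moreover have "(\<lambda>x. inv z \<otimes> x) ` {x \<in> carrier G. x [^] k = y} \<subseteq> Tor G k"
    using z by (auto simp: Tor_def pow_mult_distrib m_comm nat_pow_inv)
  moreover have "finite (Tor G k)" using assms by (simp add: Tor_def)
  ultimately show ?thesis by (rule card_inj_on_le)
next
  case True
  then show ?thesis by (simp only: card.empty)
qed

text \<open>Union bound over the exponents and the targets. With \<open>C\<close> a set of
  combinations it bounds the number of elements unsuitable for enlarging \<open>A\<close>.\<close>

lemma card_power_preimage_le:
  assumes "finite (carrier G)" "finite C"
  shows "card {x \<in> carrier G. \<exists>k\<in>{1..t}. x [^] (k::nat) \<in> C} \<le> card C * tor_sum G t"
proof -
  let ?R = "\<lambda>k y. {x \<in> carrier G. x [^] (k::nat) = y}"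
  have "card {x \<in> carrier G. \<exists>k\<in>{1..t}. x [^] k \<in> C} = card (\<Union>k\<in>{1..t}. \<Union>y\<in>C. ?R k y)"
    by (rule arg_cong[of _ _ card]) auto
  also have "\<dots> \<le> (\<Sum>k\<in>{1..t}. card (\<Union>y\<in>C. ?R k y))"
    by (rule card_UN_le) simp
  also have "\<dots> \<le> (\<Sum>k\<in>{1..t}. card C * card (Tor G k))"
  proof (rule sum_mono)
    fix k
    have "card (\<Union>y\<in>C. ?R k y) \<le> (\<Sum>y\<in>C. card (?R k y))"
      using assms(2) by (rule card_UN_le)
    also have "\<dots> \<le> (\<Sum>y\<in>C. card (Tor G k))"
      using assms(1) by (intro sum_mono card_roots_le_Tor)
    finally show "card (\<Union>y\<in>C. ?R k y) \<le> card C * card (Tor G k)" by simp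
  qed
  also have "\<dots> = card C * tor_sum G t"
    by (simp add: tor_sum_def sum_distrib_left)
  finally show ?thesis .
qed

section \<open>Enlarging an independent set\<close>

text \<open>Shows that an \<open>x\<close> outside \<open>combos G A (t - 1)\<close> lies outside
  \<open>A\<close>, so inserting it raises the cardinality. Here \<open>2 \<le> t\<close> supplies
  \<open>1 \<le> r\<close>.\<close>

lemma mem_combos:
  assumes "finite A" "A \<subseteq> carrier G" "x \<in> A" "1 \<le> r"
  shows "x \<in> combos G A r"
proof -
  let ?l = "\<lambda>a. if a = x then 1 else 0 :: int"
  have "finprod G (\<lambda>a. a [^] ?l a) A = finprod G (\<lambda>a. if x = a then a else \<one>) A"
    using assms by (intro finprod_cong') auto
  also have "\<dots> = x"
    using assms finprod_singleton[of x A "\<lambda>a. a"] by auto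
  finally have "x = finprod G (\<lambda>a. a [^] ?l a) A" ..
  moreover have "(\<Sum>a\<in>A. \<bar>?l a\<bar>) \<le> int r"
  proof -
    have "(\<Sum>a\<in>A. \<bar>?l a\<bar>) = (\<Sum>a\<in>A. ?l a)" by (intro sum.cong) auto
    then show ?thesis using assms by simp
  qed
  ultimately show ?thesis
    unfolding combos_def by (intro CollectI exI[of _ ?l] conjI)
qed

text \<open>A relation of norm at most \<open>t\<close> with nonzero coefficient at \<open>x\<close>
  can be solved for a power of \<open>x\<close>, contradicting \<open>new\<close>. With coefficient
  zero it is a relation on \<open>A\<close> alone.\<close>

lemma t_independent_insert:
  assumes A: "A = {} \<or> t_independent G t A"
    and x: "x \<in> carrier G" "x \<notin> A"
    and new: "\<And>k. k \<in> {1..t} \<Longrightarrow> x [^] k \<notin> combos G A (t - 1)"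
  shows "t_independent G t (insert x A)"
proof -
  have sub: "A \<subseteq> carrier G" and fin: "finite A"
    using A by (auto simp: t_independent_def)
  have "\<forall>a\<in>insert x A. l a = 0"
    if prod: "finprod G (\<lambda>a. a [^] l a) (insert x A) = \<one>"
      and norm: "(\<Sum>a\<in>insert x A. \<bar>l a\<bar>) \<le> int t" for l :: "'a \<Rightarrow> int"
  proof -
    let ?P = "finprod G (\<lambda>a. a [^] l a) A"
    have P: "?P \<in> carrier G" using sub by (rule finprod_int_pow_closed)
    have prod': "x [^] l x \<otimes> ?P = \<one>"
      using prod fin sub x by (simp add: finprod_int_pow_insert)
    have norm': "\<bar>l x\<bar> + (\<Sum>a\<in>A. \<bar>l a\<bar>) \<le> int t"
      using norm fin x by simp
    have l0: "l x = 0"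
    proof (rule ccontr)
      assume nz: "l x \<noteq> 0"
      define k where "k = nat \<bar>l x\<bar>"
      have nonneg: "0 \<le> (\<Sum>a\<in>A. \<bar>l a\<bar>)" by (rule sum_nonneg) simp
      then have "\<bar>l x\<bar> \<le> int t" using norm' by linarith
      then have k: "k \<in> {1..t}" using nz by (auto simp: k_def)
      \<comment> \<open>The nonzero coefficient of \<open>x\<close> uses at least one unit of norm;
        \<open>k\<close> gives \<open>1 \<le> t\<close>, so the subtraction is not
        truncated.\<close>
      have bound: "(\<Sum>a\<in>A. \<bar>l a\<bar>) \<le> int (t - 1)"
        using nz norm' k by auto
      have "x [^] l x = inv ?P"
        using prod' P x by (intro inv_equality[symmetric]) auto
      then have eq: "x [^] l x = finprod G (\<lambda>a. a [^] (- l a)) A"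
        using sub by (simp add: finprod_int_pow_uminus)
      \<comment> \<open>For positive \<open>l x\<close> the power is the inverse of
        \<open>?P\<close>, a combination with negated coefficients; for negative \<open>l x\<close>
        it is \<open>?P\<close> itself.\<close>
      have "x [^] k \<in> combos G A (t - 1)"
      proof (cases "l x > 0")
        case True
        then have "x [^] k = x [^] l x" by (simp add: k_def flip: int_pow_int)
        then have "x [^] k = finprod G (\<lambda>a. a [^] (- l a)) A" using eq by simp
        moreover have "(\<Sum>a\<in>A. \<bar>- l a\<bar>) \<le> int (t - 1)" using bound by simp
        ultimately show ?thesis
          unfolding combos_def by (intro CollectI exI[of _ "\<lambda>a. - l a"]) simp
      next
        case False
        then have "x [^] k = x [^] (- l x)" by (simp add: k_def flip: int_pow_int)
        also have "\<dots> = inv (x [^] l x)" using x by (simp add: int_pow_neg)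
        also have "\<dots> = ?P" using \<open>x [^] l x = inv ?P\<close> P by simp
        finally show ?thesis using bound unfolding combos_def by blast
      qed
      then show False using new k by blast
    qed
    have "\<forall>a\<in>A. l a = 0"
      using A l0 prod' norm' P by (auto simp: t_independent_def)
    then show ?thesis using l0 by simp
  qed
  moreover have "insert x A \<subseteq> carrier G" "finite (insert x A)" "insert x A \<noteq> {}"
    using sub fin x by auto
  ultimately show ?thesis unfolding t_independent_def by blast
qed

lemma t_independent_extend:
  assumes fin: "finite (carrier G)" and "2 \<le> t"
    and A: "A = {} \<or> t_independent G t A"
    and large: "2 * (card A + 1) ^ (t - 1) * tor_sum G t \<le> order G"
  obtains x where "x \<notin> A" "t_independent G t (insert x A)"
proof -
  let ?C = "combos G A (t - 1)"
  let ?bad = "{x \<in> carrier G. \<exists>k\<in>{1..t}. x [^] (k::nat) \<in> ?C}"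
  have sub: "A \<subseteq> carrier G" and finA: "finite A"
    using A by (auto simp: t_independent_def)
  have finC: "finite ?C" using combos_subset_carrier[OF sub] fin finite_subset by blast
  have less: "card ?C < 2 * (card A + 1) ^ (t - 1)" using fin sub by (rule card_combos_less)
  have "card ?bad < order G"
  \<comment> \<open>The strict bound on \<open>card ?C\<close> survives multiplication only by a
    positive factor, hence the separate zero case.\<close>
  proof (cases "tor_sum G t = 0")
    case True
    then have "card ?bad \<le> 0" using card_power_preimage_le[OF fin finC, of t] by simp
    then show ?thesis using order_gt_0_iff_finite fin by linarith
  next
    case False
    then have "card ?C * tor_sum G t < 2 * (card A + 1) ^ (t - 1) * tor_sum G t"
      using less by (intro mult_strict_right_mono) auto
    then show ?thesis using card_power_preimage_le[OF fin finC, of t] large by linarith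
  qed
  then have "\<not> carrier G \<subseteq> ?bad"
    using card_mono[of ?bad "carrier G"] fin by (auto simp: order_def)
  then obtain x where "x \<in> carrier G" "x \<notin> ?bad" by (meson subsetI)
  then have x: "x \<in> carrier G" "\<And>k. k \<in> {1..t} \<Longrightarrow> x [^] k \<notin> ?C" by simp_all
  have "x \<notin> ?C" and "1 \<le> t - 1" using x(2)[of 1] x(1) \<open>2 \<le> t\<close> by simp_all
  then have "x \<notin> A" using mem_combos[OF finA sub] by blast
  moreover have "t_independent G t (insert x A)"
    using A x(1) \<open>x \<notin> A\<close> by (rule t_independent_insert) (rule x(2))
  ultimately show thesis by (rule that)
qed

text \<open>Greedy construction, one element at a time. The alternative \<open>A = {}\<close> starts
  the induction, since \<open>t_independent\<close> excludes the empty set.\<close>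

lemma ex_t_independent_card:
  assumes "finite (carrier G)" "2 \<le> t" "2 * q ^ t * tor_sum G t \<le> order G"
  shows "\<exists>A. card A = q \<and> finite A \<and> (A = {} \<or> t_independent G t A)"
proof -
  have "\<exists>A. card A = m \<and> finite A \<and> (A = {} \<or> t_independent G t A)" if "m \<le> q" for m
    using that
  proof (induction m)
    case 0
    show ?case by (rule exI[of _ "{}"]) simp
  next
    case (Suc m)
    then obtain A where A: "card A = m" "finite A" "A = {} \<or> t_independent G t A" by auto
    \<comment> \<open>Every intermediate size satisfies \<open>m + 1 \<le> q\<close>, so the single
      hypothesis on \<open>q\<close> serves all extensions.\<close>
    have "(m + 1) ^ (t - 1) \<le> q ^ (t - 1)" using Suc.prems by (intro power_mono) auto
    also have "\<dots> \<le> q ^ t" using Suc.prems by (intro power_increasing) auto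
    finally have "2 * (card A + 1) ^ (t - 1) * tor_sum G t \<le> order G"
      using assms(3) A(1) by (meson le_trans mult_le_mono1 mult_le_mono2)
    then obtain x where "x \<notin> A" "t_independent G t (insert x A)"
      using t_independent_extend assms A(3) by blast
    then show ?case using A by (intro exI[of _ "insert x A"]) simp
  qed
  then show ?thesis by blast
qed

lemma card_le_max_indep_size:
  assumes "finite (carrier G)" "A = {} \<or> t_independent G t A"
  shows "card A \<le> max_indep_size G t"
proof -
  have "{A. t_independent G t A} \<subseteq> Pow (carrier G)" by (auto simp: t_independent_def)
  then have "finite {A. t_independent G t A}"
    using assms(1) by (meson finite_Pow_iff finite_subset)
  then show ?thesis
    using assms(2) unfolding max_indep_size_def by (intro Max_ge) auto
qed

end

theorem theorem7:
  fixes G :: "('a, 'b) monoid_scheme" and n t :: nat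
  assumes "comm_group G"
    and "finite (carrier G)"
    and "order G = n"
    and "2 \<le> n"
    and "2 \<le> t"
    and "t \<le> n - 1"
  shows "int (max_indep_size G t) \<ge> \<lfloor>(real n / (2 * real (tor_sum G t))) powr (1 / real t)\<rfloor>"
proof -
  interpret comm_group G by fact
  let ?x = "real n / (2 * real (tor_sum G t))"
  define q where "q = nat \<lfloor>?x powr (1 / real t)\<rfloor>"
  have q: "int q = \<lfloor>?x powr (1 / real t)\<rfloor>" by (simp add: q_def)
  \<comment> \<open>The identity makes \<open>tor_sum G t\<close> positive, so the quotient
    \<open>?x\<close> has a nonzero denominator and is itself positive.\<close>
  have "\<one>\<^bsub>G\<^esub> \<in> Tor G 1" by (simp add: Tor_def)
  then have "0 < card (Tor G 1)" using assms(2) by (auto simp: card_gt_0_iff Tor_def)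
  then have pos: "0 < tor_sum G t"
    using assms(5) unfolding tor_sum_def by (intro sum_pos2[of _ 1]) auto
  then have x: "0 < ?x" using assms(4) by simp
  have "real q \<le> ?x powr (1 / real t)" using q by linarith
  \<comment> \<open>Taking \<open>t\<close>-th powers turns the floor of the root into the integer
    condition of \<open>ex_t_independent_card\<close>.\<close>
  then have "real q ^ t \<le> (?x powr (1 / real t)) ^ t" by (intro power_mono) auto
  also have "\<dots> = ?x"
    using x assms(5) by (intro powr_inverse_power) linarith+
  finally have "2 * real q ^ t * real (tor_sum G t) \<le> real n"
    using pos by (simp add: field_simps)
  then have "real (2 * q ^ t * tor_sum G t) \<le> real n" by simp
  then have "2 * q ^ t * tor_sum G t \<le> order G"
    using assms(3) of_nat_le_iff by blast
  then obtain A where "card A = q" "A = {} \<or> t_independent G t A"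
    using ex_t_independent_card assms(2,5) by blast
  then have "q \<le> max_indep_size G t" using card_le_max_indep_size assms(2) by blast
  then show ?thesis using q by linarith
qed

end
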